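(* Let $H=\{1,\ldots,m\}$ and $L=\{1,\ldots,n\}$ be finite sets and let $\mathcal{H}$ be the power set of $H$. Suppose $F=(f_1,\ldots,f_n)$ is an aligned tuple of nonnegative real-valued functions on $\mathcal{H}$. Let $\Pi=(\pi_1,\ldots,\pi_m)$ and $\Pi'=(\pi'_1,\ldots,\pi'_m)$ be $m$-tuples of partitions of $L$. If $\Pi'$ is coarser than $\Pi$, then $$E(\Pi',\mathbf{p},F)\ \ge\ E(\Pi,\mathbf{p},F)$$ for all $\mathbf{p}=(p_1,\ldots,p_m)\in[0,1]^m$.
   Context: Coarser: $\Pi'=(\pi'_h)$ is coarser than $\Pi=(\pi_h)$ if for every $h\in H$, any two elements of $L$ lying in the same part of $\pi_h$ also lie in the same part of $\pi'_h$. Aligned: a function $f:\mathcal{H}\to\mathbb{R}$ is increasing (resp. decreasing) at $h\in H$ if for all $S\subseteq H$ one has $f(S\cup\{h\})-f(S)\ge 0$ (resp. $\le 0$). A tuple $F=(f_1,\ldots,f_n)$ of functions on $\mathcal{H}$ is aligned if for each $h\in H$, either all the $f_l$ are increasing at $h$ or all the $f_l$ are decreasing at $h$. The measure $\mu_{\pi,p}$: let $\mathcal{L}$ be the power set of $L$. For a partition $\pi$ of $L$ and $p\in[0,1]$, construct a random subset $S\in\mathcal{L}$ as follows: for each part $M\in\pi$ toss (independently) a coin with probability $p$ of heads, and include $M$ in $S$ if heads (so $S$ is the union of the parts whose coin came up heads). Then $\mu_{\pi,p}$ is the probability measure on $\mathcal{L}$ for which $\mu_{\pi,p}(S)$ is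 the probability of obtaining $S$. The quantity $E$: let $\mathcal{T}$ be the power set of $H\times L$. For $T\in\mathcal{T}$ put $L_h=\{l\in L:(h,l)\in T\}$ for $h\in H$ and $H_l=\{h\in H:(h,l)\in T\}$ for $l\in L$; these give bijections of $\mathcal{T}$ with $\mathcal{L}^m$ and with $\mathcal{H}^n$. Define $$\mu_{\Pi,\mathbf{p}}(T)=\mu_{\pi_1,p_1}(L_1)\cdots\mu_{\pi_m,p_m}(L_m),\qquad \bar F(T)=f_1(H_1)\cdots f_n(H_n),$$ and $$E(\Pi,\mathbf{p},F)=\sum_{T\in\mathcal{T}}\bar F(T)\,\mu_{\Pi,\mathbf{p}}(T).$$ *)

theory Defs
  imports "HOL-Probability.Probability"
begin

text \<open>Tuples indexed by a finite set \<open>H\<close> or \<open>L\<close> are total functions on the index type; every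
  condition and every sum or product is relativised to the index set, so their values outside
  it play no role. Likewise, a function on the power set of \<open>H\<close> is a function on
  \<open>'h set\<close> of which only the values at subsets of \<open>H\<close> are used.\<close>

definition increasing_at :: "'h set \<Rightarrow> ('h set \<Rightarrow> real) \<Rightarrow> 'h \<Rightarrow> bool" where
  "increasing_at H f h \<longleftrightarrow> (\<forall>S. S \<subseteq> H \<longrightarrow> f (S \<union> {h}) - f S \<ge> 0)"

definition decreasing_at :: "'h set \<Rightarrow> ('h set \<Rightarrow> real) \<Rightarrow> 'h \<Rightarrow> bool" where
  "decreasing_at H f h \<longleftrightarrow> (\<forall>S. S \<subseteq> H \<longrightarrow> f (S \<union> {h}) - f S \<le> 0)"

definition aligned :: "'h set \<Rightarrow> 'l set \<Rightarrow> ('l \<Rightarrow> 'h set \<Rightarrow> real) \<Rightarrow> bool" where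
  "aligned H L f \<longleftrightarrow>
     (\<forall>h\<in>H. (\<forall>l\<in>L. increasing_at H (f l) h) \<or> (\<forall>l\<in>L. decreasing_at H (f l) h))"

definition same_part :: "'l set set \<Rightarrow> 'l \<Rightarrow> 'l \<Rightarrow> bool" where
  "same_part \<pi> x y \<longleftrightarrow> (\<exists>M\<in>\<pi>. x \<in> M \<and> y \<in> M)"

definition coarser ::
  "'h set \<Rightarrow> 'l set \<Rightarrow> ('h \<Rightarrow> 'l set set) \<Rightarrow> ('h \<Rightarrow> 'l set set) \<Rightarrow> bool" where
  "coarser H L \<pi>' \<pi> \<longleftrightarrow>
     (\<forall>h\<in>H. \<forall>x\<in>L. \<forall>y\<in>L. same_part (\<pi> h) x y \<longrightarrow> same_part (\<pi>' h) x y)"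

text \<open>The distribution of the union of the parts whose coin \<open>c\<close> shows heads, where the coins
  are independent and show heads with probability \<open>p\<close>. The value \<open>False\<close> is only
  the default of \<open>c\<close> outside \<open>\<pi>\<close>.\<close>

definition random_union :: "'l set set \<Rightarrow> real \<Rightarrow> 'l set pmf" where
  "random_union \<pi> p =
     map_pmf (\<lambda>c. \<Union>{M \<in> \<pi>. c M}) (Pi_pmf \<pi> False (\<lambda>_. bernoulli_pmf p))"

definition row :: "'l set \<Rightarrow> ('h \<times> 'l) set \<Rightarrow> 'h \<Rightarrow> 'l set" where
  "row L T h = {l \<in> L. (h, l) \<in> T}"

definition col :: "'h set \<Rightarrow> ('h \<times> 'l) set \<Rightarrow> 'l \<Rightarrow> 'h set" where
  "col H T l = {h \<in> H. (h, l) \<in> T}"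

definition mu_tuple ::
  "'h set \<Rightarrow> 'l set \<Rightarrow> ('h \<Rightarrow> 'l set set) \<Rightarrow> ('h \<Rightarrow> real) \<Rightarrow> ('h \<times> 'l) set \<Rightarrow> real" where
  "mu_tuple H L \<pi> p T = (\<Prod>h\<in>H. pmf (random_union (\<pi> h) (p h)) (row L T h))"

definition F_bar :: "'h set \<Rightarrow> 'l set \<Rightarrow> ('l \<Rightarrow> 'h set \<Rightarrow> real) \<Rightarrow> ('h \<times> 'l) set \<Rightarrow> real" where
  "F_bar H L f T = (\<Prod>l\<in>L. f l (col H T l))"

definition E_val ::
  "'h set \<Rightarrow> 'l set \<Rightarrow> ('h \<Rightarrow> 'l set set) \<Rightarrow> ('h \<Rightarrow> real) \<Rightarrow> ('l \<Rightarrow> 'h set \<Rightarrow> real) \<Rightarrow> real" where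
  "E_val H L \<pi> p f = (\<Sum>T\<in>Pow (H \<times> L). F_bar H L f T * mu_tuple H L \<pi> p T)"

end

theory Submission
  imports Defs
begin

text \<open>
  It suffices to coarsen a single partition \<open>\<pi> h\<close>, since \<open>\<pi>'\<close> is reached from
  \<open>\<pi>\<close> by replacing one row at a time (\<open>E_val_mono_coarser\<close>). Fix the random
  sets of all rows other than \<open>h\<close> (\<open>E_val_condition_on_row\<close>). What remains random is, for
  each \<open>l\<close>, whether \<open>h\<close> joins the column of \<open>l\<close>, so that the factor of \<open>l\<close> takes one of two
  values \<open>x l\<close>, \<open>y l\<close>. Coins of different parts are independent, so the conditional expectation
  is the product over the parts \<open>M\<close> of \<open>p * (\<Prod>l\<in>M. x l) + (1 - p) * (\<Prod>l\<in>M. y l)\<close>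
  (\<open>expectation_random_union\<close>).

  Alignment says that \<open>x l - y l\<close> has the same sign for all \<open>l\<close>. As the values are nonnegative,
  the products over the parts are then monotone functions of their coins, all in the same
  direction. Gluing several parts together makes their coins equal instead of independent, and
  for monotone functions this can only raise the expectation of the product: this is
  Chebyshev's correlation inequality for a two-point distribution
  (\<open>prod_mixture_le_mixture_prod\<close>). The inequality thus holds already conditionally on the other
  rows, and no correlation between different rows has to be controlled.
\<close>

section \<open>Correlation under a single coin\<close>

text \<open>Chebyshev's inequality for a single coin: the product of the means of random variables that
  are all increasing or all decreasing in the coin is at most the mean of their product. For two
  variables the gap is \<open>p * (1 - p) * (x\<^sub>1 - y\<^sub>1) * (x\<^sub>2 - y\<^sub>2)\<close>; the induction uses this with
  the product of the earlier variables as one of the two, which nonnegativity keeps monotone.\<close>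

lemma prod_mixture_le_mixture_prod:
  fixes x y :: "'i \<Rightarrow> real"
  assumes "finite I" and p: "0 \<le> p" "p \<le> 1"
    and nonneg: "\<And>i. i \<in> I \<Longrightarrow> 0 \<le> x i" "\<And>i. i \<in> I \<Longrightarrow> 0 \<le> y i"
    and comparable: "(\<forall>i\<in>I. y i \<le> x i) \<or> (\<forall>i\<in>I. x i \<le> y i)"
  shows "(\<Prod>i\<in>I. p * x i + (1 - p) * y i) \<le> p * (\<Prod>i\<in>I. x i) + (1 - p) * (\<Prod>i\<in>I. y i)"
  using assms(1) nonneg comparable
proof (induction I rule: finite_induct)
  case empty
  then show ?case by simp
next
  case (insert j J)
  let ?X = "\<Prod>i\<in>J. x i" and ?Y = "\<Prod>i\<in>J. y i"
  have IH: "(\<Prod>i\<in>J. p * x i + (1 - p) * y i) \<le> p * ?X + (1 - p) * ?Y"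
    using insert.prems by (intro insert.IH) auto
  have "0 \<le> p * x j + (1 - p) * y j"
    using p insert.prems by simp
  then have "(\<Prod>i\<in>insert j J. p * x i + (1 - p) * y i)
      \<le> (p * x j + (1 - p) * y j) * (p * ?X + (1 - p) * ?Y)"
    using insert.hyps IH by (simp add: mult_left_mono)
  also have "\<dots> = p * (x j * ?X) + (1 - p) * (y j * ?Y) - p * (1 - p) * ((x j - y j) * (?X - ?Y))"
    by (simp add: algebra_simps)
  also have "\<dots> \<le> p * (x j * ?X) + (1 - p) * (y j * ?Y)"
  proof -
    have "0 \<le> (x j - y j) * (?X - ?Y)"
      using insert.prems(3)
    proof
      assume "\<forall>i\<in>insert j J. y i \<le> x i"
      then show ?thesis
        using insert.prems by (intro mult_nonneg_nonneg) (auto intro!: prod_mono)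
    next
      assume "\<forall>i\<in>insert j J. x i \<le> y i"
      then show ?thesis
        using insert.prems by (intro mult_nonpos_nonpos) (auto intro!: prod_mono)
    qed
    then show ?thesis using p by simp
  qed
  finally show ?case using insert.hyps by simp
qed

section \<open>The random union of a single row\<close>

lemma prod_over_parts:
  assumes "finite L" "partition_on L \<pi>"
  shows "(\<Prod>l\<in>L. g l) = (\<Prod>M\<in>\<pi>. \<Prod>l\<in>M. g l)"
proof -
  have "(\<Prod>l\<in>\<Union>\<pi>. g l) = (\<Prod>M\<in>\<pi>. \<Prod>l\<in>M. g l)"
    using assms finite_elements[OF assms]
    by (subst prod.Union_disjoint)
       (auto simp: partition_on_def disjoint_def intro: finite_subset)
  then show ?thesis using partition_onD1[OF assms(2)] by simp
qed

text \<open>The integrand factors over the parts, and the factor of a part depends on its own coin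
  only.\<close>

lemma expectation_random_union:
  fixes x y :: "'l \<Rightarrow> real"
  assumes L: "finite L" and part: "partition_on L \<pi>" and p: "0 \<le> p" "p \<le> 1"
    and nonneg: "\<And>l. l \<in> L \<Longrightarrow> 0 \<le> x l" "\<And>l. l \<in> L \<Longrightarrow> 0 \<le> y l"
  shows "(\<Sum>S\<in>Pow L. (\<Prod>l\<in>L. if l \<in> S then x l else y l) * pmf (random_union \<pi> p) S)
       = (\<Prod>M\<in>\<pi>. p * (\<Prod>l\<in>M. x l) + (1 - p) * (\<Prod>l\<in>M. y l))"
proof -
  let ?g = "\<lambda>S. \<Prod>l\<in>L. if l \<in> S then x l else y l"
  let ?C = "Pi_pmf \<pi> False (\<lambda>_. bernoulli_pmf p)"
  have fin: "finite \<pi>" by (rule finite_elements[OF L part])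
  have "set_pmf (random_union \<pi> p) \<subseteq> Pow L"
    using partition_onD1[OF part] by (auto simp: random_union_def)
  then have "(\<Sum>S\<in>Pow L. ?g S * pmf (random_union \<pi> p) S) = measure_pmf.expectation (random_union \<pi> p) ?g"
    using L by (subst integral_measure_pmf_real[where A = "Pow L"]) auto
  also have "\<dots> = measure_pmf.expectation ?C (\<lambda>c. ?g (\<Union>{M \<in> \<pi>. c M}))"
    by (simp add: random_union_def)
  also have "\<dots> = measure_pmf.expectation ?C
      (\<lambda>c. \<Prod>M\<in>\<pi>. if c M then (\<Prod>l\<in>M. x l) else (\<Prod>l\<in>M. y l))"
  proof (rule arg_cong[where f = "measure_pmf.expectation ?C"], rule ext)
    fix c
    have heads: "l \<in> \<Union>{M \<in> \<pi>. c M} \<longleftrightarrow> c M" if "M \<in> \<pi>" "l \<in> M" for l M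
    proof
      assume "l \<in> \<Union>{M \<in> \<pi>. c M}"
      then obtain N where "N \<in> \<pi>" "c N" "l \<in> N" by blast
      then show "c M"
        using that disjointD[OF partition_onD2[OF part], of M N] by (cases "M = N") auto
    qed (use that in blast)
    have "?g (\<Union>{M \<in> \<pi>. c M})
        = (\<Prod>M\<in>\<pi>. \<Prod>l\<in>M. if l \<in> \<Union>{M \<in> \<pi>. c M} then x l else y l)"
      by (rule prod_over_parts[OF L part])
    also have "\<dots> = (\<Prod>M\<in>\<pi>. \<Prod>l\<in>M. if c M then x l else y l)"
      by (intro prod.cong refl if_cong heads)
    also have "\<dots> = (\<Prod>M\<in>\<pi>. if c M then (\<Prod>l\<in>M. x l) else (\<Prod>l\<in>M. y l))"
      by (intro prod.cong refl) simp
    finally show "?g (\<Union>{M \<in> \<pi>. c M}) = (\<Prod>M\<in>\<pi>. if c M then (\<Prod>l\<in>M. x l) else (\<Prod>l\<in>M. y l))" .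
  qed
  also have "\<dots> = (\<Prod>M\<in>\<pi>. measure_pmf.expectation (bernoulli_pmf p)
      (\<lambda>b. if b then (\<Prod>l\<in>M. x l) else (\<Prod>l\<in>M. y l)))"
  proof (rule expectation_prod_Pi_pmf[OF fin])
    show "0 \<le> (if b then (\<Prod>l\<in>M. x l) else (\<Prod>l\<in>M. y l))" if "M \<in> \<pi>" for M b
      using that nonneg partition_onD1[OF part] by (auto intro!: prod_nonneg)
  qed (auto intro: integrable_measure_pmf_finite)
  finally show ?thesis using p by (simp add: mult.commute)
qed

text \<open>Every part of the coarser partition is partitioned by the finer parts inside it, so the
  claim is the coin inequality within each coarse part, applied to the products over the finer
  parts.\<close>

lemma coarser_prod_mixture_le:
  fixes x y :: "'l \<Rightarrow> real"
  assumes L: "finite L" and part: "partition_on L \<pi>" and part': "partition_on L \<pi>'"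
    and coarser: "\<And>a b. a \<in> L \<Longrightarrow> b \<in> L \<Longrightarrow> same_part \<pi> a b \<Longrightarrow> same_part \<pi>' a b"
    and p: "0 \<le> p" "p \<le> 1"
    and nonneg: "\<And>l. l \<in> L \<Longrightarrow> 0 \<le> x l" "\<And>l. l \<in> L \<Longrightarrow> 0 \<le> y l"
    and comparable: "(\<forall>l\<in>L. y l \<le> x l) \<or> (\<forall>l\<in>L. x l \<le> y l)"
  shows "(\<Prod>M\<in>\<pi>. p * (\<Prod>l\<in>M. x l) + (1 - p) * (\<Prod>l\<in>M. y l))
       \<le> (\<Prod>N\<in>\<pi>'. p * (\<Prod>l\<in>N. x l) + (1 - p) * (\<Prod>l\<in>N. y l))"
proof -
  let ?mix = "\<lambda>M. p * (\<Prod>l\<in>M. x l) + (1 - p) * (\<Prod>l\<in>M. y l)"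
  define sub where "sub N = {M \<in> \<pi>. M \<subseteq> N}" for N
  have fin: "finite \<pi>" "finite \<pi>'" by (rule finite_elements[OF L] part part')+
  have in_L: "M \<subseteq> L" if "M \<in> \<pi>" for M
    using that partition_onD1[OF part] by auto
  have in_L': "N \<subseteq> L" if "N \<in> \<pi>'" for N
    using that partition_onD1[OF part'] by auto
  have swallow: "M \<subseteq> N" if "M \<in> \<pi>" "N \<in> \<pi>'" "a \<in> M" "a \<in> N" for M N a
  proof
    fix b assume "b \<in> M"
    then have "same_part \<pi>' a b"
      using that in_L by (intro coarser) (auto simp: same_part_def)
    then show "b \<in> N"
      using that partition_onD2[OF part'] by (auto simp: same_part_def disjoint_def)
  qed
  have nonempty: "\<exists>a. a \<in> M" if "M \<in> \<pi>" for M
    using that partition_onD3[OF part] by (metis ex_in_conv)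
  have sub_part: "partition_on N (sub N)" if "N \<in> \<pi>'" for N
  proof (rule partition_onI)
    show "\<Union>(sub N) = N"
    proof
      show "\<Union>(sub N) \<subseteq> N" by (auto simp: sub_def)
      show "N \<subseteq> \<Union>(sub N)"
      proof
        fix a assume a: "a \<in> N"
        then obtain M where "M \<in> \<pi>" "a \<in> M"
          using in_L'[OF \<open>N \<in> \<pi>'\<close>] partition_onD1[OF part] by auto
        then show "a \<in> \<Union>(sub N)"
          using swallow[OF _ \<open>N \<in> \<pi>'\<close> _ a] by (auto simp: sub_def)
      qed
    qed
  next
    show "disjnt M M'" if "M \<in> sub N" "M' \<in> sub N" "M \<noteq> M'" for M M'
      using that partition_onD2[OF part] by (auto simp: sub_def disjoint_def disjnt_def)
  next
    show "{} \<notin> sub N"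
      using nonempty by (auto simp: sub_def)
  qed
  have "\<pi> = (\<Union>N\<in>\<pi>'. sub N)"
  proof
    show "\<pi> \<subseteq> (\<Union>N\<in>\<pi>'. sub N)"
    proof
      fix M assume M: "M \<in> \<pi>"
      then obtain a where a: "a \<in> M" using nonempty by blast
      then obtain N where "N \<in> \<pi>'" "a \<in> N"
        using in_L[OF M] partition_onD1[OF part'] by auto
      then show "M \<in> (\<Union>N\<in>\<pi>'. sub N)"
        using swallow[OF M _ a] M by (auto simp: sub_def)
    qed
  qed (auto simp: sub_def)
  then have "(\<Prod>M\<in>\<pi>. ?mix M) = (\<Prod>M\<in>(\<Union>N\<in>\<pi>'. sub N). ?mix M)"
    by simp
  also have "\<dots> = (\<Prod>N\<in>\<pi>'. \<Prod>M\<in>sub N. ?mix M)"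
  proof (rule prod.UNION_disjoint)
    show "\<forall>N\<in>\<pi>'. \<forall>N'\<in>\<pi>'. N \<noteq> N' \<longrightarrow> sub N \<inter> sub N' = {}"
    proof (intro ballI impI)
      fix N N' assume N: "N \<in> \<pi>'" "N' \<in> \<pi>'" "N \<noteq> N'"
      then have "N \<inter> N' = {}"
        using partition_onD2[OF part'] by (simp add: disjoint_def)
      then have "M = {}" if "M \<in> sub N" "M \<in> sub N'" for M
        using that by (auto simp: sub_def)
      then show "sub N \<inter> sub N' = {}"
        using nonempty by (fastforce simp: sub_def)
    qed
    show "\<forall>N\<in>\<pi>'. finite (sub N)"
      using fin by (simp add: sub_def)
  qed (rule fin)
  also have "\<dots> \<le> (\<Prod>N\<in>\<pi>'. ?mix N)"
  proof (rule prod_mono, intro conjI)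
    fix N assume N: "N \<in> \<pi>'"
    have finN: "finite N" using in_L'[OF N] L by (rule finite_subset)
    have sub_L: "l \<in> L" if "M \<in> sub N" "l \<in> M" for M l
      using that in_L by (auto simp: sub_def)
    have nn: "0 \<le> (\<Prod>l\<in>M. x l)" "0 \<le> (\<Prod>l\<in>M. y l)" if "M \<in> sub N" for M
      using sub_L[OF that] nonneg by (auto intro!: prod_nonneg)
    show "0 \<le> (\<Prod>M\<in>sub N. ?mix M)"
      using nn p by (intro prod_nonneg) simp
    have "(\<forall>M\<in>sub N. (\<Prod>l\<in>M. y l) \<le> (\<Prod>l\<in>M. x l)) \<or> (\<forall>M\<in>sub N. (\<Prod>l\<in>M. x l) \<le> (\<Prod>l\<in>M. y l))"
      using comparable
    proof
      assume "\<forall>l\<in>L. y l \<le> x l"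
      then show ?thesis
        using sub_L nonneg by (intro disjI1 ballI prod_mono) blast
    next
      assume "\<forall>l\<in>L. x l \<le> y l"
      then show ?thesis
        using sub_L nonneg by (intro disjI2 ballI prod_mono) blast
    qed
    then have "(\<Prod>M\<in>sub N. ?mix M)
        \<le> p * (\<Prod>M\<in>sub N. \<Prod>l\<in>M. x l) + (1 - p) * (\<Prod>M\<in>sub N. \<Prod>l\<in>M. y l)"
      using fin nn p by (intro prod_mixture_le_mixture_prod) (auto simp: sub_def)
    then show "(\<Prod>M\<in>sub N. ?mix M) \<le> ?mix N"
      by (simp add: prod_over_parts[OF finN sub_part[OF N]])
  qed
  finally show ?thesis .
qed

section \<open>Coarsening one row at a time\<close>

text \<open>Splitting \<open>T\<close> into its row \<open>h\<close> and the remaining rows; the inner sum is the conditional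
  expectation of the product over the columns, given the remaining rows, in the form to which
  \<open>expectation_random_union\<close> applies.\<close>

lemma E_val_condition_on_row:
  fixes H :: "'h set" and L :: "'l set"
  assumes H: "finite H" "h \<in> H" and L: "finite L"
  shows "E_val H L \<pi> p f =
    (\<Sum>T\<in>Pow ((H - {h}) \<times> L). mu_tuple (H - {h}) L \<pi> p T *
      (\<Sum>S\<in>Pow L. (\<Prod>l\<in>L. if l \<in> S then f l (col H T l \<union> {h}) else f l (col H T l))
         * pmf (random_union (\<pi> h) (p h)) S))"
proof -
  let ?G = "\<lambda>T S. F_bar H L f (T \<union> {h} \<times> S) * mu_tuple H L \<pi> p (T \<union> {h} \<times> S)"
  have "E_val H L \<pi> p f = (\<Sum>(T, S)\<in>Pow ((H - {h}) \<times> L) \<times> Pow L. ?G T S)"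
    unfolding E_val_def
    by (rule sum.reindex_bij_witness[where
          i = "\<lambda>(T, S). T \<union> {h} \<times> S" and j = "\<lambda>T. (T - {h} \<times> L, row L T h)"])
       (use H in \<open>auto simp: row_def intro!: arg_cong2[where f = "(*)"] arg_cong[where f = "F_bar H L f"]
           arg_cong[where f = "mu_tuple H L \<pi> p"]\<close>)
  also have "\<dots> = (\<Sum>T\<in>Pow ((H - {h}) \<times> L). \<Sum>S\<in>Pow L. ?G T S)"
    by (rule sum.cartesian_product[symmetric])
  also have "\<dots> = (\<Sum>T\<in>Pow ((H - {h}) \<times> L). \<Sum>S\<in>Pow L. mu_tuple (H - {h}) L \<pi> p T *
      ((\<Prod>l\<in>L. if l \<in> S then f l (col H T l \<union> {h}) else f l (col H T l))
         * pmf (random_union (\<pi> h) (p h)) S))"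
  proof (intro sum.cong refl)
    fix T S assume T: "T \<in> Pow ((H - {h}) \<times> L)" and S: "S \<in> Pow L"
    have "F_bar H L f (T \<union> {h} \<times> S) =
        (\<Prod>l\<in>L. if l \<in> S then f l (col H T l \<union> {h}) else f l (col H T l))"
      unfolding F_bar_def
      by (intro prod.cong refl) (use H in \<open>auto simp: col_def intro!: arg_cong[where f = "f _"]\<close>)
    moreover have "mu_tuple H L \<pi> p (T \<union> {h} \<times> S) =
        pmf (random_union (\<pi> h) (p h)) S * mu_tuple (H - {h}) L \<pi> p T"
    proof -
      have "row L (T \<union> {h} \<times> S) h = S"
        using T S by (auto simp: row_def)
      moreover have "row L (T \<union> {h} \<times> S) k = row L T k" if "k \<in> H - {h}" for k
        using that by (auto simp: row_def)
      ultimately show ?thesis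
        unfolding mu_tuple_def prod.remove[OF H] by simp
    qed
    ultimately show "?G T S = mu_tuple (H - {h}) L \<pi> p T *
      ((\<Prod>l\<in>L. if l \<in> S then f l (col H T l \<union> {h}) else f l (col H T l))
         * pmf (random_union (\<pi> h) (p h)) S)"
      by (simp add: mult_ac)
  qed
  finally show ?thesis by (simp add: sum_distrib_left)
qed

text \<open>Given the other rows, alignment at \<open>h\<close> is what makes the two values of all column factors
  comparable in the same direction, whatever the columns contain so far.\<close>

lemma E_val_coarsen_row:
  fixes H :: "'h set" and L :: "'l set"
  assumes H: "finite H" "h \<in> H" and L: "finite L"
    and nonneg: "\<And>l S. l \<in> L \<Longrightarrow> S \<subseteq> H \<Longrightarrow> 0 \<le> f l S"
    and aligned: "aligned H L f"
    and part: "partition_on L (\<pi> h)" and part': "partition_on L (\<pi>' h)"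
    and coarser: "\<And>a b. a \<in> L \<Longrightarrow> b \<in> L \<Longrightarrow> same_part (\<pi> h) a b \<Longrightarrow> same_part (\<pi>' h) a b"
    and other_rows: "\<And>k. k \<in> H - {h} \<Longrightarrow> \<pi>' k = \<pi> k"
    and p: "0 \<le> p h" "p h \<le> 1"
  shows "E_val H L \<pi> p f \<le> E_val H L \<pi>' p f"
  unfolding E_val_condition_on_row[OF H L]
proof (rule sum_mono)
  fix T
  let ?x = "\<lambda>l. f l (col H T l \<union> {h})" and ?y = "\<lambda>l. f l (col H T l)"
  let ?row = "\<lambda>\<rho>. \<Sum>S\<in>Pow L. (\<Prod>l\<in>L. if l \<in> S then ?x l else ?y l)
      * pmf (random_union (\<rho> h) (p h)) S"
  have col: "col H T l \<subseteq> H" for l by (auto simp: col_def)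
  have "(\<forall>l\<in>L. ?y l \<le> ?x l) \<or> (\<forall>l\<in>L. ?x l \<le> ?y l)"
    using aligned H(2) col unfolding aligned_def increasing_at_def decreasing_at_def
    by (metis diff_ge_0_iff_ge diff_le_0_iff_le)
  moreover have nn: "0 \<le> ?x l" "0 \<le> ?y l" if "l \<in> L" for l
    using that col H(2) by (auto intro!: nonneg)
  ultimately have "?row \<pi> \<le> ?row \<pi>'"
    using coarser_prod_mixture_le[OF L part part' coarser p, of ?x ?y]
    by (simp only: expectation_random_union[OF L part p nn] expectation_random_union[OF L part' p nn])
  moreover have "mu_tuple (H - {h}) L \<pi>' p T = mu_tuple (H - {h}) L \<pi> p T"
    unfolding mu_tuple_def by (intro prod.cong refl) (simp add: other_rows)
  moreover have "0 \<le> mu_tuple (H - {h}) L \<pi> p T"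
    unfolding mu_tuple_def by (intro prod_nonneg) auto
  ultimately show "mu_tuple (H - {h}) L \<pi> p T * ?row \<pi> \<le> mu_tuple (H - {h}) L \<pi>' p T * ?row \<pi>'"
    by (simp add: mult_left_mono)
qed

lemma E_val_mono_coarser:
  fixes H :: "'h set" and L :: "'l set"
  assumes H: "finite H" and L: "finite L"
    and nonneg: "\<And>l S. l \<in> L \<Longrightarrow> S \<subseteq> H \<Longrightarrow> 0 \<le> f l S"
    and aligned: "aligned H L f"
    and part: "\<And>h. h \<in> H \<Longrightarrow> partition_on L (\<pi> h)"
    and part': "\<And>h. h \<in> H \<Longrightarrow> partition_on L (\<pi>' h)"
    and coarser: "coarser H L \<pi>' \<pi>"
    and p: "\<And>h. h \<in> H \<Longrightarrow> 0 \<le> p h \<and> p h \<le> 1"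
  shows "E_val H L \<pi> p f \<le> E_val H L \<pi>' p f"
proof -
  define hybrid where "hybrid A h = (if h \<in> A then \<pi>' h else \<pi> h)" for A h
  have "E_val H L \<pi> p f \<le> E_val H L (hybrid A) p f" if "A \<subseteq> H" for A
    using finite_subset[OF that H] that
  proof (induction A rule: finite_induct)
    case empty
    have "hybrid {} = \<pi>" by (simp add: hybrid_def fun_eq_iff)
    then show ?case by simp
  next
    case (insert h A)
    then have "E_val H L \<pi> p f \<le> E_val H L (hybrid A) p f" by simp
    also have "\<dots> \<le> E_val H L (hybrid (insert h A)) p f"
    proof (rule E_val_coarsen_row[OF H _ L nonneg aligned])
      show "h \<in> H" using insert.prems by simp
      show "partition_on L (hybrid A h)" "partition_on L (hybrid (insert h A) h)"
        using insert.hyps insert.prems part part' by (auto simp: hybrid_def)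
      show "same_part (hybrid (insert h A) h) a b"
        if "a \<in> L" "b \<in> L" "same_part (hybrid A h) a b" for a b
        using that insert.hyps insert.prems coarser by (auto simp: hybrid_def coarser_def)
      show "hybrid (insert h A) k = hybrid A k" if "k \<in> H - {h}" for k
        using that by (simp add: hybrid_def)
      show "0 \<le> p h" "p h \<le> 1"
        using insert.prems p by simp_all
    qed
    finally show ?case .
  qed
  then have "E_val H L \<pi> p f \<le> E_val H L (hybrid H) p f" by simp
  also have "\<dots> = E_val H L \<pi>' p f"
    unfolding E_val_def mu_tuple_def
    by (intro sum.cong arg_cong2[where f = "(*)"] prod.cong refl) (simp add: hybrid_def)
  finally show ?thesis .
qed

theorem theoremD:
  fixes m n :: nat and H L :: "nat set"
    and f :: "nat \<Rightarrow> nat set \<Rightarrow> real"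
    and \<pi> \<pi>' :: "nat \<Rightarrow> nat set set"
  assumes H: "H = {1..m}" and L: "L = {1..n}"
    and nonneg: "\<And>l S. l \<in> L \<Longrightarrow> S \<subseteq> H \<Longrightarrow> f l S \<ge> 0"
    and aligned: "aligned H L f"
    and part: "\<And>h. h \<in> H \<Longrightarrow> partition_on L (\<pi> h)"
    and part': "\<And>h. h \<in> H \<Longrightarrow> partition_on L (\<pi>' h)"
    and coarser: "coarser H L \<pi>' \<pi>"
  shows "\<forall>p :: nat \<Rightarrow> real. (\<forall>h\<in>H. p h \<in> {0..1}) \<longrightarrow> E_val H L \<pi>' p f \<ge> E_val H L \<pi> p f"
proof (intro allI impI)
  fix p :: "nat \<Rightarrow> real" assume p: "\<forall>h\<in>H. p h \<in> {0..1}"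
  show "E_val H L \<pi>' p f \<ge> E_val H L \<pi> p f"
  proof (rule E_val_mono_coarser)
    show "finite H" "finite L" by (simp_all add: H L)
    show "0 \<le> p h \<and> p h \<le> 1" if "h \<in> H" for h
      using bspec[OF p that] by simp
  qed (fact nonneg aligned part part' coarser)+
qed

end
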